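(* Let $\phi_{A,B}(\cdot)$ be a class of limiter functions characterized by two parameters $A,B$ with $0<B<\min(2,2A)$. Define the conjugate class of limiter functions by $\phi^*_{A,B}=\phi_{1/A,\,B/A}$. A sufficient condition for the class $\phi_{A,B}$ to preserve symmetric solutions (in the sense defined in the context) is $$\frac{\phi_{A,B}(\theta)}{\theta}=\phi^*_{A,B}\left(\frac1\theta\right)$$ (for all $\theta\neq0$ and all such pairs $(A,B)$).
   Context: Scheme. For a grid with cell sizes $\Delta x_j>0$, a constant speed $a$, a time step $\Delta t^n$, $\lambda_j=|a|\Delta t^n/\Delta x_j$, and limiter functions $\phi_j$, the reconstruct-evolve-project scheme for $w_t+aw_x=0$ is $$w_j^{n+1}=w_j^n-\lambda_j(w_j^n-w_{j'}^n)-\operatorname{sgn}(a)\,\tfrac12\lambda_j\left[(1-\lambda_j)\Delta x_j\sigma_j^n-(1-\lambda_{j'})\Delta x_{j'}\sigma_{j'}^n\right],$$ where $j'=j-1$ if $a>0$, $j'=j+1$ if $a<0$, and $$\sigma_j^n=\frac{1}{\Delta x_j}\phi_j(\theta_j)(w_{j+1}^n-w_j^n),\qquad\theta_j=\frac{w_j^n-w_{j-1}^n}{w_{j+1}^n-w_j^n}.$$ Symmetry preservation. The class $\phi_{A,B}(\cdot)$ preserves symmetric solutions if the following two problems (with the same time step $\Delta t^n$) lead to $u_i^{n+1}=v_i^{n+1}$ for all $i$. Problem 1: given the grid with cell sizes $\Delta x^u_{i+k}$ and corresponding data $u^n_{i+k}$ at $t^n$, $k=0,\pm1,\dots$, solve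 $u_t+cu_x=0$ ($c$ constant) for $u_i^{n+1}$ by the scheme, using in each cell $j$ the limiter function $\phi^u_j=\phi_{A^u_j,B^u_j}$ with $$A^u_j=\frac{\Delta x^u_{j-1}+\Delta x^u_j}{\Delta x^u_j+\Delta x^u_{j+1}},\qquad B^u_j=\frac{2\Delta x^u_j}{\Delta x^u_j+\Delta x^u_{j+1}}.$$ Problem 2: given the grid with cell sizes $\Delta x^v_{i+k}$ and corresponding data $v^n_{i+k}$ at $t^n$, $k=0,\pm1,\dots$, such that $\Delta x^v_{i+k}=\Delta x^u_{i-k}$ and $v^n_{i+k}=u^n_{i-k}$, solve $v_t-cv_x=0$ for $v_i^{n+1}$ by the scheme, using in each cell $j$ the limiter function $\phi^v_j=\phi_{A^v_j,B^v_j}$ with $$A^v_j=\frac{\Delta x^v_{j-1}+\Delta x^v_j}{\Delta x^v_j+\Delta x^v_{j+1}},\qquad B^v_j=\frac{2\Delta x^v_j}{\Delta x^v_j+\Delta x^v_{j+1}}.$$ *)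

theory Defs
  imports Complex_Main
begin

text \<open>Grids and grid functions at one time level are functions on \<^typ>\<open>int\<close>; a limiter family
  \<open>phi\<close> below assigns to each cell its limiter function.\<close>

definition courant :: "real \<Rightarrow> real \<Rightarrow> (int \<Rightarrow> real) \<Rightarrow> int \<Rightarrow> real" where
  "courant a dt dx j = \<bar>a\<bar> * dt / dx j"

text \<open>For \<open>a = 0\<close> the value is irrelevant, since all Courant numbers vanish.\<close>

definition upwind :: "real \<Rightarrow> int \<Rightarrow> int" where
  "upwind a j = (if a > 0 then j - 1 else j + 1)"

definition ratio :: "(int \<Rightarrow> real) \<Rightarrow> int \<Rightarrow> real" where
  "ratio w j = (w j - w (j - 1)) / (w (j + 1) - w j)"

definition slope ::
  "(int \<Rightarrow> real \<Rightarrow> real) \<Rightarrow> (int \<Rightarrow> real) \<Rightarrow> (int \<Rightarrow> real) \<Rightarrow> int \<Rightarrow> real" where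
  "slope phi dx w j = 1 / dx j * phi j (ratio w j) * (w (j + 1) - w j)"

definition rep_step ::
  "real \<Rightarrow> real \<Rightarrow> (int \<Rightarrow> real \<Rightarrow> real) \<Rightarrow> (int \<Rightarrow> real) \<Rightarrow> (int \<Rightarrow> real) \<Rightarrow> int \<Rightarrow> real" where
  "rep_step a dt phi dx w j =
     (let j' = upwind a j; l = courant a dt dx in
      w j - l j * (w j - w j')
        - sgn a * (1 / 2) * l j *
          ((1 - l j) * dx j * slope phi dx w j - (1 - l j') * dx j' * slope phi dx w j'))"

definition admissible :: "real \<Rightarrow> real \<Rightarrow> bool" where
  "admissible A B \<longleftrightarrow> 0 < B \<and> B < min 2 (2 * A)"

definition conjugate_class ::
  "(real \<Rightarrow> real \<Rightarrow> real \<Rightarrow> real) \<Rightarrow> real \<Rightarrow> real \<Rightarrow> real \<Rightarrow> real" where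
  "conjugate_class \<phi> A B = \<phi> (1 / A) (B / A)"

definition grid_A :: "(int \<Rightarrow> real) \<Rightarrow> int \<Rightarrow> real" where
  "grid_A dx j = (dx (j - 1) + dx j) / (dx j + dx (j + 1))"

definition grid_B :: "(int \<Rightarrow> real) \<Rightarrow> int \<Rightarrow> real" where
  "grid_B dx j = 2 * dx j / (dx j + dx (j + 1))"

definition grid_limiter ::
  "(real \<Rightarrow> real \<Rightarrow> real \<Rightarrow> real) \<Rightarrow> (int \<Rightarrow> real) \<Rightarrow> int \<Rightarrow> real \<Rightarrow> real" where
  "grid_limiter \<phi> dx j = \<phi> (grid_A dx j) (grid_B dx j)"

text \<open>The formula for the slope in cell \<open>j\<close> has a meaning if the denominator of the ratio is
  nonzero. If \<open>w\<close> is constant on the cells \<open>j - 1\<close>, \<open>j\<close>, \<open>j + 1\<close>, the slope is \<open>0\<close>. In the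
  remaining case \<open>w (j - 1) \<noteq> w j = w (j + 1)\<close> the ratio is infinite and the formula reads
  \<open>\<phi>(\<plusminus>\<infinity>) * 0\<close>. The usual convention that the slope is then \<open>0\<close> is right for limiters that
  vanish at \<open>0\<close> (the mirrored cell has ratio \<open>0\<close>), but not in general: the choice
  \<open>\<phi>(\<theta>) = (1 + \<theta>) / 2\<close>, which satisfies the conjugacy relation for \<open>A = B = 1\<close>, has the one-sided
  limit \<open>(w j - w (j - 1)) / 2\<close> of \<open>\<phi>(\<theta>) * (w (j + 1) - w j)\<close>. So there the scheme is regarded as
  undefined unless the class vanishes at \<open>0\<close>. In HOL, \<open>x / 0 = 0\<close> makes \<open>slope\<close> equal to \<open>0\<close>
  whenever \<open>w (j + 1) = w j\<close>, in accordance with these conventions.\<close>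

definition slope_defined ::
  "(real \<Rightarrow> real \<Rightarrow> real \<Rightarrow> real) \<Rightarrow> (int \<Rightarrow> real) \<Rightarrow> int \<Rightarrow> bool" where
  "slope_defined \<phi> w j \<longleftrightarrow>
     w (j + 1) \<noteq> w j \<or> w j = w (j - 1) \<or> (\<forall>A B. admissible A B \<longrightarrow> \<phi> A B 0 = 0)"

definition step_defined ::
  "(real \<Rightarrow> real \<Rightarrow> real \<Rightarrow> real) \<Rightarrow> real \<Rightarrow> (int \<Rightarrow> real) \<Rightarrow> int \<Rightarrow> bool" where
  "step_defined \<phi> a w j \<longleftrightarrow> slope_defined \<phi> w j \<and> slope_defined \<phi> w (upwind a j)"

definition preserves_symmetric_solutions :: "(real \<Rightarrow> real \<Rightarrow> real \<Rightarrow> real) \<Rightarrow> bool" where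
  "preserves_symmetric_solutions \<phi> \<longleftrightarrow>
     (\<forall>c dt dxu dxv u v i.
        dt > 0 \<longrightarrow>
        (\<forall>j. dxu j > 0) \<longrightarrow>
        (\<forall>k. dxv (i + k) = dxu (i - k)) \<longrightarrow>
        (\<forall>k. v (i + k) = u (i - k)) \<longrightarrow>
        step_defined \<phi> c u i \<longrightarrow>
        step_defined \<phi> (- c) v i \<longrightarrow>
        rep_step c dt (grid_limiter \<phi> dxu) dxu u i
          = rep_step (- c) dt (grid_limiter \<phi> dxv) dxv v i)"

end

theory Submission
  imports Defs
begin

text \<open>The mirrored problem reverses the two one-sided differences that enter a cell: if
  \<open>e = u q - u (q - 1)\<close> and \<open>d = u (q + 1) - u q\<close>, the image cell has backward difference
  \<open>- d\<close> and forward difference \<open>- e\<close>, hence ratio \<open>d / e = 1 / \<theta>\<close>, where \<open>\<theta> = e / d\<close>. Its grid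
  parameters are \<open>1 / A\<close> and \<open>B / A\<close>, so its limiter is exactly the conjugate one. The hypothesis
  \<open>\<phi> A B \<theta> = \<theta> * \<phi>\<^sup>* (1 / \<theta>)\<close>, multiplied by \<open>d\<close>, reads
  \<open>\<phi> A B (e / d) * d = \<phi>\<^sup>* (d / e) * e\<close>, which says that the reconstructed slope changes sign
  under reflection, as the derivative of a mirrored function must (lemma \<open>slope_reflect\<close>).
  If exactly one of \<open>d\<close>, \<open>e\<close> vanishes, one of the two slopes is \<open>0\<close> by convention, and
  definedness of that slope forces \<open>\<phi>\<close> to vanish at \<open>0\<close>, which makes the other slope \<open>0\<close> too.

  In the update itself, reflection maps the upwind cell for speed \<open>c\<close> to the one for \<open>- c\<close>,
  keeps the Courant numbers, and flips both \<open>sgn c\<close> and the slopes; the two sign changes cancel.\<close>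

lemma admissible_grid:
  assumes "\<forall>j. dx j > 0"
  shows "admissible (grid_A dx j) (grid_B dx j)"
proof -
  have "dx (j - 1) > 0" "dx j > 0" "dx (j + 1) > 0"
    using assms by blast+
  then show ?thesis
    by (simp add: admissible_def grid_A_def grid_B_def field_simps add_pos_pos)
qed

lemma grid_parameters_reflect:
  assumes "\<forall>j. dxu j > 0" and "\<And>j. dxv j = dxu (m - j)"
  shows "grid_A dxv (m - q) = 1 / grid_A dxu q"
    and "grid_B dxv (m - q) = grid_B dxu q / grid_A dxu q"
proof -
  have pos: "dxu (q - 1) > 0" "dxu q > 0" "dxu (q + 1) > 0"
    using assms(1) by blast+
  have nb: "dxv (m - q) = dxu q" "dxv (m - q - 1) = dxu (q + 1)" "dxv (m - q + 1) = dxu (q - 1)"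
    by (simp_all add: assms(2) algebra_simps)
  show "grid_A dxv (m - q) = 1 / grid_A dxu q"
    unfolding grid_A_def nb using pos by (simp add: add.commute)
  show "grid_B dxv (m - q) = grid_B dxu q / grid_A dxu q"
    unfolding grid_A_def grid_B_def nb using pos by (simp add: add.commute)
qed

lemma slope_reflect:
  fixes \<phi> :: "real \<Rightarrow> real \<Rightarrow> real \<Rightarrow> real"
  assumes conj: "\<And>A B \<theta>. admissible A B \<Longrightarrow> \<theta> \<noteq> 0 \<Longrightarrow>
             \<phi> A B \<theta> / \<theta> = conjugate_class \<phi> A B (1 / \<theta>)"
    and pos: "\<forall>j. dxu j > 0"
    and dxv: "\<And>j. dxv j = dxu (m - j)"
    and v: "\<And>j. v j = u (m - j)"
    and def_u: "slope_defined \<phi> u q"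
    and def_v: "slope_defined \<phi> v (m - q)"
  shows "slope (grid_limiter \<phi> dxv) dxv v (m - q) = - slope (grid_limiter \<phi> dxu) dxu u q"
proof -
  define A B where "A = grid_A dxu q" and "B = grid_B dxu q"
  define e d where "e = u q - u (q - 1)" and "d = u (q + 1) - u q"
  have nb: "v (m - q) = u q" "v (m - q - 1) = u (q + 1)" "v (m - q + 1) = u (q - 1)"
    by (simp_all add: v algebra_simps)
  have adm: "admissible A B"
    unfolding A_def B_def by (rule admissible_grid[OF pos])
  have "\<forall>j. dxv j > 0"
    using pos dxv by simp
  then have "admissible (grid_A dxv (m - q)) (grid_B dxv (m - q))"
    by (rule admissible_grid)
  then have adm': "admissible (1 / A) (B / A)"
    by (simp add: grid_parameters_reflect[OF pos dxv] A_def B_def)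
  have su: "slope (grid_limiter \<phi> dxu) dxu u q = 1 / dxu q * (\<phi> A B (e / d) * d)"
    by (simp add: slope_def grid_limiter_def ratio_def A_def B_def d_def e_def)
  have "ratio v (m - q) = (- d) / (- e)"
    by (simp add: ratio_def nb d_def e_def)
  then have "ratio v (m - q) = d / e"
    by simp
  moreover have "v (m - q + 1) - v (m - q) = - e"
    by (simp add: nb e_def)
  moreover have "dxv (m - q) = dxu q"
    by (simp add: dxv)
  moreover have "grid_limiter \<phi> dxv (m - q) = \<phi> (1 / A) (B / A)"
    by (simp add: grid_limiter_def grid_parameters_reflect[OF pos dxv] A_def B_def)
  ultimately have sv: "slope (grid_limiter \<phi> dxv) dxv v (m - q)
      = 1 / dxu q * (\<phi> (1 / A) (B / A) (d / e) * (- e))"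
    by (simp add: slope_def)
  have "\<phi> A B (e / d) * d = \<phi> (1 / A) (B / A) (d / e) * e"
  proof (cases "d = 0 \<or> e = 0")
    case False
    then have "\<phi> A B (e / d) / (e / d) = \<phi> (1 / A) (B / A) (1 / (e / d))"
      using conj[OF adm, of "e / d"] by (simp add: conjugate_class_def)
    with False show ?thesis
      by (simp add: field_simps)
  next
    case True
    have "d = e \<or> (\<forall>A B. admissible A B \<longrightarrow> \<phi> A B 0 = 0)"
      using True def_u def_v by (auto simp: slope_defined_def nb d_def e_def)
    with True adm adm' show ?thesis
      by auto
  qed
  then show ?thesis
    by (simp add: su sv)
qed

theorem mainTheorem3:
  fixes \<phi> :: "real \<Rightarrow> real \<Rightarrow> real \<Rightarrow> real"
  assumes "\<And>A B \<theta>. admissible A B \<Longrightarrow> \<theta> \<noteq> 0 \<Longrightarrow>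
             \<phi> A B \<theta> / \<theta> = conjugate_class \<phi> A B (1 / \<theta>)"
  shows "preserves_symmetric_solutions \<phi>"
  unfolding preserves_symmetric_solutions_def
proof (intro allI impI)
  fix c dt :: real and dxu dxv u v :: "int \<Rightarrow> real" and i :: int
  assume pos: "\<forall>j. dxu j > 0"
    and dx_sym: "\<forall>k. dxv (i + k) = dxu (i - k)"
    and v_sym: "\<forall>k. v (i + k) = u (i - k)"
    and def_u: "step_defined \<phi> c u i"
    and def_v: "step_defined \<phi> (- c) v i"
  have dxv: "dxv j = dxu (2 * i - j)" for j
    using dx_sym[rule_format, of "j - i"] by (simp add: algebra_simps)
  have v: "v j = u (2 * i - j)" for j
    using v_sym[rule_format, of "j - i"] by (simp add: algebra_simps)
  show "rep_step c dt (grid_limiter \<phi> dxu) dxu u i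
      = rep_step (- c) dt (grid_limiter \<phi> dxv) dxv v i"
  proof (cases "c = 0")
    \<comment> \<open>For \<open>c = 0\<close> the two upwind cells coincide instead of being mirror images.\<close>
    case True
    then show ?thesis
      by (simp add: rep_step_def courant_def v)
  next
    case False
    define q where "q = upwind c i"
    have up: "upwind (- c) i = 2 * i - q"
      using False by (auto simp: upwind_def q_def)
    have def_i: "slope_defined \<phi> u i" "slope_defined \<phi> v (2 * i - i)"
      and def_q: "slope_defined \<phi> u q" "slope_defined \<phi> v (2 * i - q)"
      using def_u def_v by (simp_all add: step_defined_def up q_def)
    have reflect: "slope (grid_limiter \<phi> dxv) dxv v (2 * i - r)
        = - slope (grid_limiter \<phi> dxu) dxu u r"
      if "slope_defined \<phi> u r" "slope_defined \<phi> v (2 * i - r)" for r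
      by (rule slope_reflect) (use assms pos dxv v that in auto)
    have si: "slope (grid_limiter \<phi> dxv) dxv v i = - slope (grid_limiter \<phi> dxu) dxu u i"
      using reflect[OF def_i] by simp
    note sq = reflect[OF def_q]
    have vals: "dxv i = dxu i" "dxv (2 * i - q) = dxu q" "v i = u i" "v (2 * i - q) = u q"
      by (simp_all add: dxv v)
    have cour: "courant (- c) dt dxv i = courant c dt dxu i"
      "courant (- c) dt dxv (2 * i - q) = courant c dt dxu q"
      by (simp_all add: courant_def vals)
    have "sgn (- c) = - sgn c"
      by (simp add: sgn_minus)
    then show ?thesis
      unfolding rep_step_def Let_def up q_def[symmetric] si sq vals cour by (simp add: algebra_simps)
  qed
qed

end
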